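(* Let $X$ be a normed space, $Y$ a Hilbert space, and $T\in LR(X,Y)$. Then $$\|\hat T_s(x)\|=\|T(x)\|\ \text{ for all } x\in D(T),\qquad \|\hat T_s\|=\|T\|,$$ and consequently $T$ is bounded if and only if $\hat T_s$ is bounded. Furthermore, if $X=Y$ is a Hilbert space and $T$ is a closed subspace of $X\times X$, then $$\|T_s(x)\|=\|\hat T_s(x)\|=\|T(x)\|\ \text{ for all } x\in D(T),\qquad \|T_s\|=\|\hat T_s\|=\|T\|,$$ and consequently the boundedness of $T$, of $\hat T_s$, and of $T_s$ are equivalent in this case.
   Context: All spaces are over the same scalar field ($\mathbf R$ or $\mathbf C$). $LR(X,Y)$ is the set of all linear subspaces of $X\times Y$. For $T\in LR(X,Y)$: $D(T)$ is its domain, $T(x)=\{y\in Y:(x,y)\in T\}$. A (single-valued) linear operator is identified with its graph; $G(U)$ is the graph of an operator $U$. Products: $ST=\{(x,z):\exists y,\ (x,y)\in T,\ (y,z)\in S\}$. If a subspace is single-valued, its value at $x$ is identified with its unique element. For $Y$ normed, $Q_T:Y\to Y/\overline{T(0)}$, $y\mapsto[y]$, is the quotient map, where the quotient has norm $\|[y]\|=\inf\{\|y-e\|:e\in\overline{T(0)}\}$; $\tilde T_s:=G(Q_T)\,T$ is a linear operator with domain $D(T)$, i.e. $\tilde T_s(x)=[y]$ for any $y\in T(x)$. For $X,Y$ normed, define $\|T(x)\|:=\|\tilde T_s(x)\|$ for $x\in D(T)$ and $\|T\|:=\|\tilde T_s\|=\sup\{\|\tilde T_s(x)\|:x\in D(T),\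 \|x\|\le1\}\in[0,\infty]$. $T$ is bounded if $\|T\|<\infty$. (For single-valued $T$ these are the usual notions.) For $Y$ Hilbert, $P_T:Y\to\overline{T(0)}^\perp$ is the orthogonal projection and $\hat T_s:=G(P_T)\,T\in LR(X,Y)$, a linear operator with domain $D(T)$. For $X$ Hilbert and $T$ a closed subspace of $X\times X$ (with inner product $\langle(x_1,y_1),(x_2,y_2)\rangle=\langle x_1,x_2\rangle+\langle y_1,y_2\rangle$), $T_\infty:=\{(0,g)\in X^2:(0,g)\in T\}$ and $T_s:=T\ominus T_\infty$ (orthogonal complement of $T_\infty$ in $T$), a linear operator with domain $D(T)$. *)

theory Defs
  imports "HOL-Analysis.Analysis" "HOL-Library.Extended_Nonnegative_Real"
begin

section \<open>The scalar field\<close>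

text \<open>
  The axioms say that every scalar is a root of the real quadratic polynomial
  with coefficients \<open>- 2 sre a\<close> and \<open>\<bar>a\<bar>\<^sup>2\<close>, so the only models are the real numbers and the
  complex numbers with their usual conjugation; see \<open>real_or_complex_cases\<close> below.
\<close>

class real_or_complex = real_normed_field +
  fixes sre :: "'a \<Rightarrow> real" and sconj :: "'a \<Rightarrow> 'a"
  assumes sconj_add: "sconj (a + b) = sconj a + sconj b"
    and sconj_mult: "sconj (a * b) = sconj a * sconj b"
    and sconj_sconj: "sconj (sconj a) = a"
    and sconj_scaleR_one: "sconj (r *\<^sub>R 1) = r *\<^sub>R 1"
    and add_sconj_scaleR: "a + sconj a = (2 * sre a) *\<^sub>R 1"
    and mult_sconj_scaleR: "a * sconj a = (norm a)\<^sup>2 *\<^sub>R 1"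

lemma sconj_of_real: "sconj (of_real r) = of_real r"
  and add_sconj: "a + sconj a = of_real (2 * sre a)"
  and mult_sconj: "a * sconj a = of_real ((norm a)\<^sup>2)"
  for a :: "'a::real_or_complex"
  by (simp_all add: of_real_def sconj_scaleR_one add_sconj_scaleR mult_sconj_scaleR)

instantiation real :: real_or_complex
begin
definition sre_real :: "real \<Rightarrow> real" where "sre_real a = a"
definition sconj_real :: "real \<Rightarrow> real" where "sconj_real a = a"
instance
  by standard (auto simp: sre_real_def sconj_real_def power2_eq_square)
end

instantiation complex :: real_or_complex
begin
definition sre_complex :: "complex \<Rightarrow> real" where "sre_complex a = Re a"
definition sconj_complex :: "complex \<Rightarrow> complex" where "sconj_complex a = cnj a"
instance
proof
  fix a b :: complex and r :: real
  show "a + sconj a = (2 * sre a) *\<^sub>R 1"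
    by (simp add: sre_complex_def sconj_complex_def complex_eq_iff)
  show "a * sconj a = (norm a)\<^sup>2 *\<^sub>R 1"
    unfolding sconj_complex_def scaleR_conv_of_real by (simp only: complex_norm_square mult_1_right)
qed (simp_all add: sconj_complex_def)
end

lemma real_or_complex_cases:
  "(\<forall>a::'k::real_or_complex. a \<in> \<real>) \<or>
   (\<exists>i::'k. i * i = - 1 \<and> sconj i = - i \<and> (\<forall>a::'k. \<exists>r s. a = of_real r + of_real s * i))"
proof (cases "\<forall>a::'k. a \<in> \<real>")
  case False
  have sconj_real: "sconj (of_real r :: 'k) = of_real r" for r by (rule sconj_of_real)
  have sconj_minus: "sconj (- b) = - sconj b" for b :: 'k
    using sconj_add[of "- b" b] sconj_real[of 0] by (simp add: eq_neg_iff_add_eq_0)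
  have sconj_imag: "sconj (a - of_real (sre a)) = - (a - of_real (sre a))" for a :: 'k
  proof -
    have "sconj (a - of_real (sre a)) = sconj a - of_real (sre a)"
      using sconj_add[of a "- of_real (sre a)"] sconj_real[of "sre a"] by (simp add: sconj_minus)
    moreover have "sconj a = of_real (sre a) + of_real (sre a) - a"
      using add_sconj[of a] by (simp add: eq_diff_eq add.commute)
    ultimately show ?thesis by simp
  qed
  obtain a :: 'k where a: "a \<notin> \<real>" using False by blast
  define u where "u = a - of_real (sre a)"
  have u0: "u \<noteq> 0" using a unfolding u_def by (metis Reals_of_real right_minus_eq)
  have cu: "sconj u = - u" unfolding u_def by (rule sconj_imag)
  define i where "i = of_real (inverse (norm u)) * u"
  have ci: "sconj i = - i" unfolding i_def by (simp only: sconj_mult sconj_of_real cu mult_minus_right)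
  have "norm i = 1" using u0 by (simp add: i_def norm_mult norm_inverse)
  then have ii: "i * i = - 1" using mult_sconj[of i] by (simp add: ci) (metis minus_minus)
  have "\<exists>r s. b = of_real r + of_real s * i" for b :: 'k
  proof -
    define v where "v = b - of_real (sre b)"
    have cv: "sconj v = - v" unfolding v_def by (rule sconj_imag)
    have "sconj (v * i) = v * i" by (simp add: sconj_mult ci cv)
    then have "2 * (v * i) = 2 * of_real (sre (v * i))" using add_sconj[of "v * i"]
      by (simp only: of_real_add mult_2)
    then have vi: "v * i = of_real (sre (v * i))"
      by (metis mult_left_cancel zero_neq_numeral)
    have "v = - (v * i) * i" using ii by (simp add: mult.assoc)
    then have "v = of_real (- sre (v * i)) * i" by (metis vi of_real_minus)
    then have "b = of_real (sre b) + of_real (- sre (v * i)) * i" by (simp add: v_def)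
    then show ?thesis by blast
  qed
  then show ?thesis using ii ci by blast
qed simp


section \<open>Normed spaces and Hilbert spaces\<close>

text \<open>
  The type class supplies addition, norm, topology and the underlying real scaling, with which
  multiplication by scalars has to agree.
\<close>

locale normed_space_over = vector_space scale
  for scale :: "'k::real_or_complex \<Rightarrow> 'a::real_normed_vector \<Rightarrow> 'a" +
  assumes norm_scale: "norm (scale c x) = norm c * norm x"
    and scale_of_real: "scale (of_real r) x = r *\<^sub>R x"

text \<open>
  The sort \<open>banach\<close> makes the space complete.
\<close>

locale hilbert_space_over = normed_space_over scale
  for scale :: "'k::real_or_complex \<Rightarrow> 'b::banach \<Rightarrow> 'b" +
  fixes ip :: "'b \<Rightarrow> 'b \<Rightarrow> 'k"
  assumes ip_add_left: "ip (x + y) z = ip x z + ip y z"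
    and ip_scale_left: "ip (scale c x) y = c * ip x y"
    and ip_commute: "ip y x = sconj (ip x y)"
    and ip_self: "ip x x = of_real ((norm x)\<^sup>2)"

lemma normed_space_over_scaleR:
  "normed_space_over (scaleR :: real \<Rightarrow> 'a::real_normed_vector \<Rightarrow> 'a)"
  by unfold_locales (auto simp: algebra_simps)

lemma hilbert_space_over_real_inner:
  "hilbert_space_over (scaleR :: real \<Rightarrow> 'b::{real_inner, banach} \<Rightarrow> 'b) inner"
  by unfold_locales (auto simp: algebra_simps inner_commute sconj_real_def power2_norm_eq_inner)

lemma hilbert_space_over_complex:
  "hilbert_space_over ((*) :: complex \<Rightarrow> complex \<Rightarrow> complex) (\<lambda>x y. x * cnj y)"
  by unfold_locales (auto simp: algebra_simps norm_mult scaleR_conv_of_real sconj_complex_def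
      complex_norm_square simp flip: of_real_power)


section \<open>Linear relations\<close>

text \<open>
  A relation is a set of pairs. Its domain is \<open>Domain T\<close>, the set \<open>T(x)\<close> is \<open>T `` {x}\<close>, and the
  product \<open>S T\<close> (first \<open>T\<close>, then \<open>S\<close>) is \<open>T O S\<close>.
\<close>

definition linear_relations ::
  "('k::field \<Rightarrow> 'a::ab_group_add \<Rightarrow> 'a) \<Rightarrow> ('k \<Rightarrow> 'b::ab_group_add \<Rightarrow> 'b) \<Rightarrow> ('a \<times> 'b) set set"
  where "linear_relations scaleX scaleY =
    {T. module.subspace (module_prod.scale scaleX scaleY) T}"

definition graph_of :: "('a \<Rightarrow> 'b) \<Rightarrow> ('a \<times> 'b) set"
  where "graph_of U = {(x, U x) |x. True}"

text \<open>The value at \<open>x\<close> of a relation that is single-valued at \<open>x\<close>.\<close>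

definition rel_value :: "('a \<times> 'b) set \<Rightarrow> 'a \<Rightarrow> 'b"
  where "rel_value U x = (THE y. (x, y) \<in> U)"


section \<open>The norm of a linear relation\<close>

text \<open>
  Elements of the quotient space are the cosets \<open>y +o E\<close>; the norm of a coset is the distance of
  a representative from \<open>E\<close>, i.e. the infimum of the norms of the elements of the coset.
\<close>

definition quotient_map :: "('a::zero \<times> 'b::real_normed_vector) set \<Rightarrow> 'b \<Rightarrow> 'b set"
  where "quotient_map T y = y +o closure (T `` {0})"

definition quotient_norm :: "'b::real_normed_vector set \<Rightarrow> real"
  where "quotient_norm C = (INF c\<in>C. norm c)"

definition tilde_part ::
  "('a::real_normed_vector \<times> 'b::real_normed_vector) set \<Rightarrow> ('a \<times> 'b set) set"
  where "tilde_part T = T O graph_of (quotient_map T)"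

definition lr_norm_at ::
  "('a::real_normed_vector \<times> 'b::real_normed_vector) set \<Rightarrow> 'a \<Rightarrow> real"
  where "lr_norm_at T x = quotient_norm (rel_value (tilde_part T) x)"

definition lr_norm ::
  "('a::real_normed_vector \<times> 'b::real_normed_vector) set \<Rightarrow> ennreal"
  where "lr_norm T = (SUP x\<in>{x \<in> Domain T. norm x \<le> 1}. ennreal (lr_norm_at T x))"

definition lr_bounded ::
  "('a::real_normed_vector \<times> 'b::real_normed_vector) set \<Rightarrow> bool"
  where "lr_bounded T \<longleftrightarrow> lr_norm T < \<infinity>"


section \<open>Operator parts\<close>

definition orth_compl :: "('b \<Rightarrow> 'b \<Rightarrow> 'k::zero) \<Rightarrow> 'b set \<Rightarrow> 'b set"
  where "orth_compl ip E = {y. \<forall>e\<in>E. ip y e = 0}"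

definition orth_proj :: "('b::ab_group_add \<Rightarrow> 'b \<Rightarrow> 'k::zero) \<Rightarrow> 'b set \<Rightarrow> 'b \<Rightarrow> 'b"
  where "orth_proj ip M y = (THE p. p \<in> M \<and> y - p \<in> orth_compl ip M)"

definition hat_part ::
  "('b \<Rightarrow> 'b \<Rightarrow> 'k::zero) \<Rightarrow> ('a::real_normed_vector \<times> 'b::real_normed_vector) set \<Rightarrow> ('a \<times> 'b) set"
  where "hat_part ip T = T O graph_of (orth_proj ip (orth_compl ip (closure (T `` {0}))))"

definition prod_ip :: "('a \<Rightarrow> 'a \<Rightarrow> 'k::plus) \<Rightarrow> 'a \<times> 'a \<Rightarrow> 'a \<times> 'a \<Rightarrow> 'k"
  where "prod_ip ip p q = ip (fst p) (fst q) + ip (snd p) (snd q)"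

definition infinity_part :: "('a::zero \<times> 'a) set \<Rightarrow> ('a \<times> 'a) set"
  where "infinity_part T = {(0, g) |g. (0, g) \<in> T}"

definition s_part :: "('a::zero \<Rightarrow> 'a \<Rightarrow> 'k::monoid_add) \<Rightarrow> ('a \<times> 'a) set \<Rightarrow> ('a \<times> 'a) set"
  where "s_part ip T = T \<inter> orth_compl (prod_ip ip) (infinity_part T)"


section \<open>Agreement with the usual notions\<close>

lemma quotient_norm_coset:
  fixes s :: "'k::real_or_complex \<Rightarrow> 'b::real_normed_vector \<Rightarrow> 'b"
  assumes "normed_space_over s" and "module.subspace s E"
  shows "quotient_norm (y +o E) = (INF e\<in>E. norm (y - e))"
proof -
  interpret normed_space_over s by fact
  have "y +o E = (\<lambda>e. y - e) ` E"
  proof (intro set_eqI iffI)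
    fix z assume "z \<in> y +o E"
    then obtain e where "e \<in> E" "z = y + e" by (auto simp: elt_set_plus_def)
    then show "z \<in> (\<lambda>e. y - e) ` E"
      using subspace_neg[OF assms(2)] by (intro image_eqI[of _ _ "- e"]) auto
  next
    fix z assume "z \<in> (\<lambda>e. y - e) ` E"
    then obtain e where "e \<in> E" "z = y + - e" by auto
    then show "z \<in> y +o E"
      using subspace_neg[OF assms(2)] unfolding elt_set_plus_def by blast
  qed
  then show ?thesis by (simp add: quotient_norm_def image_image)
qed

lemma linear_relations_iff:
  assumes "vector_space scaleX" and "vector_space scaleY"
  shows "T \<in> linear_relations scaleX scaleY \<longleftrightarrow>
    (0, 0) \<in> T \<and>
    (\<forall>x y x' y'. (x, y) \<in> T \<longrightarrow> (x', y') \<in> T \<longrightarrow> (x + x', y + y') \<in> T) \<and>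
    (\<forall>c x y. (x, y) \<in> T \<longrightarrow> (scaleX c x, scaleY c y) \<in> T)"
proof -
  interpret vector_space_prod scaleX scaleY
    using assms by (simp add: vector_space_prod_def vector_space_pair_def)
  show ?thesis
    unfolding linear_relations_def p.subspace_def mem_Collect_eq
    by (simp add: split_paired_Ball_Sigma scale_prod zero_prod_def)
      (simp add: Ball_def scale_prod; blast)
qed

lemma lr_norm_at_single_valued:
  fixes T :: "('a::real_normed_vector \<times> 'b::real_normed_vector) set"
  assumes "single_valued T" and "(0, 0) \<in> T" and "(x, y) \<in> T"
  shows "lr_norm_at T x = norm y"
proof -
  have "T `` {0} = {0}" using assms by (auto dest: single_valuedD)
  then have q: "quotient_map T z = {z}" for z
    by (auto simp: quotient_map_def elt_set_plus_def)
  have "(x, C) \<in> tilde_part T \<longleftrightarrow> C = {y}" for C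
    using assms by (auto simp: tilde_part_def graph_of_def q dest: single_valuedD)
  then show ?thesis by (simp add: lr_norm_at_def rel_value_def quotient_norm_def)
qed

end

theory Submission
  imports Defs
begin

text \<open>
  Write \<open>E\<close> for the closure of \<open>T(0)\<close>. It is a closed subspace of the Hilbert space \<open>Y\<close>, and any two
  elements of \<open>T(x)\<close> differ by an element of \<open>T(0)\<close>. By the projection theorem every \<open>y\<close> splits as
  \<open>y = p + e\<close> with \<open>e \<in> E\<close> and \<open>p\<close> orthogonal to \<open>E\<close>, and \<open>p\<close> has the smallest norm in the coset
  \<open>y + E\<close>. So the quotient norm of the coset of \<open>y\<close> is the norm of \<open>p\<close>, and \<open>p\<close> is the value at \<open>x\<close> of
  the operator \<open>hat_part ip T\<close> when \<open>y \<in> T(x)\<close>. This is the pointwise equality, and the equality of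
  the operator norms and the equivalence of boundedness follow because the domains coincide.

  If \<open>T\<close> is a closed relation in \<open>Y \<times> Y\<close>, then \<open>T(0)\<close> is already closed, so the component \<open>e\<close> above lies
  in \<open>T(0)\<close> and \<open>(x, p) = (x, y) - (0, e)\<close> lies in \<open>T\<close>. Therefore \<open>s_part ip T\<close> and \<open>hat_part ip T\<close> are
  the same set (\<open>s_part_eq_hat_part\<close>), and nothing remains to be compared.

  The projection theorem is proved over a scalar field that may be real or complex: a minimizing
  sequence for the distance to \<open>E\<close> is Cauchy by the parallelogram law, and its limit is the foot
  of the perpendicular.
\<close>

section \<open>Closed subspaces of a normed space\<close>

lemma (in normed_space_over) bounded_linear_scale: "bounded_linear (scale c)"
proof (rule bounded_linear_intro[where K = "norm c"])
  show "scale c (r *\<^sub>R x) = r *\<^sub>R scale c x" for r x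
    by (metis scale_left_commute scale_of_real)
qed (simp_all add: scale_right_distrib norm_scale mult.commute)

lemma (in normed_space_over) subspace_closure:
  assumes "subspace E"
  shows "subspace (closure E)"
proof (rule subspaceI)
  show "0 \<in> closure E"
    using subspace_0[OF assms] closure_subset by blast
next
  fix x y assume "x \<in> closure E" "y \<in> closure E"
  then obtain f g where fg: "\<And>n. f n \<in> E" "\<And>n. g n \<in> E" "f \<longlonglongrightarrow> x" "g \<longlonglongrightarrow> y"
    by (auto simp: closure_sequential)
  then have "(\<lambda>n. f n + g n) \<longlonglongrightarrow> x + y" "\<And>n. f n + g n \<in> E"
    using subspace_add[OF assms] by (auto intro: tendsto_add)
  then show "x + y \<in> closure E"
    unfolding closure_sequential by (intro exI[of _ "\<lambda>n. f n + g n"]) simp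
next
  fix c x assume "x \<in> closure E"
  then obtain f where f: "\<And>n. f n \<in> E" "f \<longlonglongrightarrow> x"
    by (auto simp: closure_sequential)
  then have "(\<lambda>n. scale c (f n)) \<longlonglongrightarrow> scale c x" "\<And>n. scale c (f n) \<in> E"
    using subspace_scale[OF assms] bounded_linear.tendsto[OF bounded_linear_scale] by auto
  then show "scale c x \<in> closure E"
    unfolding closure_sequential by (intro exI[of _ "\<lambda>n. scale c (f n)"]) simp
qed

section \<open>The projection theorem\<close>

context hilbert_space_over
begin

lemma sconj_0: "sconj (0 :: 'k) = 0"
  using sconj_of_real[of 0] by simp

lemma ip_zero_left: "ip 0 x = 0"
  using ip_add_left[of 0 0 x] by simp

lemma ip_add_right: "ip x (y + z) = ip x y + ip x z"
  by (metis ip_commute ip_add_left sconj_add)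

lemma ip_minus_left: "ip (- x) y = - ip x y"
  using ip_add_left[of "- x" x y] by (simp add: ip_zero_left eq_neg_iff_add_eq_0)

lemma ip_diff_left: "ip (x - y) z = ip x z - ip y z"
  using ip_add_left[of x "- y" z] by (simp add: ip_minus_left)

lemma ip_eq_0_commute: "ip x y = 0 \<longleftrightarrow> ip y x = 0"
  by (metis ip_commute sconj_0)

lemma ip_zero_right: "ip x 0 = 0"
  by (simp add: ip_eq_0_commute[of x] ip_zero_left)

lemma ip_self_eq_0: "ip x x = 0 \<longleftrightarrow> x = 0"
  by (simp add: ip_self)

lemma norm_add_sq: "(norm (x + y))\<^sup>2 = (norm x)\<^sup>2 + (norm y)\<^sup>2 + 2 * sre (ip x y)"
proof -
  have "(of_real ((norm (x + y))\<^sup>2) :: 'k) = ip x x + ip y y + (ip x y + sconj (ip x y))"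
    by (simp only: ip_self[symmetric] ip_add_left ip_add_right ip_commute[of y x] ac_simps)
  also have "\<dots> = of_real ((norm x)\<^sup>2 + (norm y)\<^sup>2 + 2 * sre (ip x y))"
    by (simp only: ip_self add_sconj of_real_add)
  finally show ?thesis
    by (simp only: of_real_eq_iff)
qed

lemma sre_zero: "sre (0 :: 'k) = 0"
  using add_sconj[of "0::'k"] by (simp add: sconj_0)

lemma pythagoras: "ip x y = 0 \<Longrightarrow> (norm (x + y))\<^sup>2 = (norm x)\<^sup>2 + (norm y)\<^sup>2"
  by (simp add: norm_add_sq sre_zero)

lemma ip_minus_right: "ip x (- y) = - ip x y"
  using ip_add_right[of x "- y" y]
  by (simp add: ip_zero_right eq_neg_iff_add_eq_0)

lemma sre_minus: "sre (- a :: 'k) = - sre a"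
proof -
  have "sconj (- a) = - sconj a"
    using sconj_add[of a "- a"] by (simp add: sconj_0 eq_neg_iff_add_eq_0 add.commute)
  then have "(of_real (2 * sre (- a)) :: 'k) = - (a + sconj a)"
    by (simp only: add_sconj[symmetric] minus_add_distrib)
  also have "\<dots> = of_real (2 * - sre a)"
    by (simp only: add_sconj of_real_minus mult_minus_right)
  finally have "2 * sre (- a) = 2 * - sre a" by (simp only: of_real_eq_iff)
  then show ?thesis by simp
qed

lemma parallelogram:
  fixes x y :: 'b
  shows "(norm (x + y))\<^sup>2 + (norm (x - y))\<^sup>2 = 2 * (norm x)\<^sup>2 + 2 * (norm y)\<^sup>2"
  using norm_add_sq[of x y] norm_add_sq[of x "- y"] by (simp add: ip_minus_right sre_minus)

text \<open>
  Let \<open>d\<close> be the distance from \<open>y\<close> to \<open>E\<close>. Midpoints of points of \<open>E\<close> stay in \<open>E\<close> and so have distance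
  at least \<open>d\<close> from \<open>y\<close>. By the parallelogram law, two points of \<open>E\<close> whose distances from \<open>y\<close> are close to
  \<open>d\<close> are then close to each other, so minimizing sequences are Cauchy.
\<close>

lemma nearest_point_exists:
  assumes E: "subspace E" "closed E"
  obtains e where "e \<in> E" "\<And>e'. e' \<in> E \<Longrightarrow> norm (y - e) \<le> norm (y - e')"
proof -
  define d where "d = infdist y E"
  have ne: "E \<noteq> {}" using subspace_0[OF E(1)] by auto
  have d: "0 \<le> d" "\<And>e. e \<in> E \<Longrightarrow> d \<le> norm (y - e)"
    using infdist_nonneg infdist_le[of _ E y] by (auto simp: d_def dist_norm)
  have "\<exists>e\<in>E. norm (y - e) < d + inverse (Suc n)" for n
  proof (rule ccontr)
    assume "\<not> ?thesis"
    then have "d + inverse (Suc n) \<le> infdist y E"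
      unfolding infdist_notempty[OF ne] by (intro cINF_greatest[OF ne]) (auto simp: dist_norm not_less)
    then show False by (simp add: d_def)
  qed
  then obtain f where f: "\<And>n. f n \<in> E" "\<And>n. norm (y - f n) < d + inverse (Suc n)"
    by metis
  have lim: "(\<lambda>n. norm (y - f n)) \<longlonglongrightarrow> d"
  proof (rule tendsto_sandwich[of "\<lambda>_. d" _ _ "\<lambda>n. d + inverse (Suc n)"])
    show "(\<lambda>n. d + inverse (Suc n)) \<longlonglongrightarrow> d"
      using tendsto_add[OF tendsto_const[of d] LIMSEQ_inverse_real_of_nat] by simp
    show "\<forall>\<^sub>F n in sequentially. norm (y - f n) \<le> d + inverse (Suc n)"
      using f(2) by (intro always_eventually allI less_imp_le)
  qed (use f(1) d(2) in simp_all)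
  have "Cauchy f"
  proof (rule metric_CauchyI)
    fix r :: real assume "r > 0"
    have "(\<lambda>n. (norm (y - f n))\<^sup>2) \<longlonglongrightarrow> d\<^sup>2" by (intro tendsto_power lim)
    then have "\<forall>\<^sub>F n in sequentially. (norm (y - f n))\<^sup>2 < d\<^sup>2 + r\<^sup>2 / 4"
      by (rule order_tendstoD) (use \<open>r > 0\<close> in simp)
    then obtain N where N: "\<And>n. n \<ge> N \<Longrightarrow> (norm (y - f n))\<^sup>2 < d\<^sup>2 + r\<^sup>2 / 4"
      by (auto simp: eventually_sequentially)
    have "dist (f m) (f n) < r" if "m \<ge> N" "n \<ge> N" for m n
    proof -
      have "scale (of_real (1/2)) (f m + f n) \<in> E"
        by (intro subspace_scale subspace_add E f)
      then have "d \<le> norm (y - (1/2) *\<^sub>R (f m + f n))"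
        unfolding scale_of_real by (rule d)
      also have "\<dots> = norm ((1/2) *\<^sub>R ((y - f m) + (y - f n)))"
        by (simp add: algebra_simps flip: scaleR_add_left)
      finally have "2 * d \<le> norm ((y - f m) + (y - f n))" by simp
      then have "(2 * d)\<^sup>2 \<le> (norm ((y - f m) + (y - f n)))\<^sup>2"
        by (rule power_mono) (use d in simp)
      moreover have "norm ((y - f m) - (y - f n)) = dist (f m) (f n)"
        by (simp add: dist_norm norm_minus_commute)
      ultimately have "(dist (f m) (f n))\<^sup>2 < r\<^sup>2"
        using parallelogram[of "y - f m" "y - f n"] N[OF that(1)] N[OF that(2)]
        by (simp add: power_mult_distrib)
      then show ?thesis using \<open>r > 0\<close> by (simp add: power2_less_imp_less)
    qed
    then show "\<exists>M. \<forall>m\<ge>M. \<forall>n\<ge>M. dist (f m) (f n) < r" by blast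
  qed
  then obtain e where e: "f \<longlonglongrightarrow> e"
    using Cauchy_convergent_iff convergent_def by blast
  have "e \<in> E" using E(2) f(1) e closed_sequential_limits by blast
  moreover have "norm (y - e) = d"
    using LIMSEQ_unique[OF lim] tendsto_norm[OF tendsto_diff[OF tendsto_const e]] by metis
  ultimately show ?thesis using that d by metis
qed

text \<open>
  Take \<open>p = y - e\<close> with \<open>e\<close> a nearest point. For \<open>z \<in> E\<close>, choose \<open>c\<close> so that \<open>p - c z\<close> is orthogonal to \<open>z\<close>.
  By the Pythagorean theorem, the squared norm of \<open>p - c z\<close> is smaller than that of \<open>p\<close> by the squared
  norm of \<open>c z\<close>. But \<open>e + c z\<close> is no nearer to \<open>y\<close> than \<open>e\<close>, so \<open>c z = 0\<close>, that is, \<open>p\<close> is orthogonal to \<open>z\<close>.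
\<close>

lemma perpendicular_exists:
  assumes E: "subspace E" "closed E"
  obtains p where "p \<in> orth_compl ip E" "y - p \<in> E"
proof -
  obtain e where e: "e \<in> E" "\<And>e'. e' \<in> E \<Longrightarrow> norm (y - e) \<le> norm (y - e')"
    using nearest_point_exists[OF E] by blast
  define p where "p = y - e"
  have "ip p z = 0" if z: "z \<in> E" for z
  proof (cases "z = 0")
    case True
    then show ?thesis by (simp add: ip_zero_right)
  next
    case False
    define c where "c = ip p z / ip z z"
    have zz: "ip z z \<noteq> 0" using False by (simp add: ip_self_eq_0)
    have "ip (p - scale c z) z = 0"
      using zz by (simp add: ip_diff_left ip_scale_left c_def)
    then have "ip (scale c z) (p - scale c z) = 0"
      by (simp add: ip_scale_left ip_eq_0_commute[of z])
    then have "(norm p)\<^sup>2 = (norm (scale c z))\<^sup>2 + (norm (p - scale c z))\<^sup>2"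
      using pythagoras[of "scale c z" "p - scale c z"] by simp
    moreover have "norm p \<le> norm (p - scale c z)"
      using e(2)[of "e + scale c z"] subspace_add[OF E(1) e(1) subspace_scale[OF E(1) z]]
      by (simp add: p_def algebra_simps)
    then have "(norm p)\<^sup>2 \<le> (norm (p - scale c z))\<^sup>2" by (simp add: power_mono)
    ultimately have "scale c z = 0" by simp
    then show ?thesis using False zz by (simp add: c_def)
  qed
  then show ?thesis
    using that[of p] e(1) by (simp add: orth_compl_def p_def)
qed

text \<open>
  The definition of the projection onto \<open>E\<^sup>\<bottom>\<close> asks for \<open>y - p\<close> in \<open>E\<^sup>\<bottom>\<^sup>\<bottom>\<close>. Membership in the smaller set
  \<open>E\<close> is what the decomposition supplies, and it is enough to identify the projection.
\<close>

lemma orth_proj_eqI: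
  assumes "p \<in> orth_compl ip E" "y - p \<in> E"
  shows "orth_proj ip (orth_compl ip E) y = p"
  unfolding orth_proj_def
proof (rule the_equality)
  show "p \<in> orth_compl ip E \<and> y - p \<in> orth_compl ip (orth_compl ip E)"
    using assms by (auto simp: orth_compl_def ip_eq_0_commute[of "y - p"])
next
  fix q assume q: "q \<in> orth_compl ip E \<and> y - q \<in> orth_compl ip (orth_compl ip E)"
  \<comment> \<open>\<open>q - p = (y - p) - (y - q)\<close> lies both in \<open>E\<^sup>\<bottom>\<close> and in \<open>E\<^sup>\<bottom>\<^sup>\<bottom>\<close>.\<close>
  have "q - p \<in> orth_compl ip E"
    using q assms(1) by (auto simp: orth_compl_def ip_diff_left)
  moreover have "ip (y - p) (q - p) = 0"
    using assms(2) calculation by (auto simp: orth_compl_def ip_eq_0_commute[of "y - p"])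
  ultimately have "ip ((y - p) - (y - q)) (q - p) = 0"
    using q unfolding ip_diff_left[of "y - p"] by (auto simp: orth_compl_def)
  then show "q = p" by (simp add: ip_self_eq_0)
qed

text \<open>
  For \<open>e \<in> E\<close> the vector \<open>y - e\<close> is the sum of \<open>p\<close> and the orthogonal vector \<open>y - p - e\<close>, so it is at
  least as long as \<open>p\<close>; the bound is attained at \<open>e = y - p\<close>.
\<close>

lemma quotient_norm_eq_norm_perpendicular:
  assumes "subspace E" "p \<in> orth_compl ip E" "y - p \<in> E"
  shows "quotient_norm (y +o E) = norm p"
proof -
  have "(INF e\<in>E. norm (y - e)) = norm p"
  proof (rule cInf_eq_minimum)
    show "norm p \<in> (\<lambda>e. norm (y - e)) ` E"
      using assms(3) by (intro image_eqI[of _ _ "y - p"]) auto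
  next
    fix r assume "r \<in> (\<lambda>e. norm (y - e)) ` E"
    then obtain e where "e \<in> E" "r = norm (y - e)" by blast
    have "y - p - e \<in> E" by (rule subspace_diff[OF assms(1,3) \<open>e \<in> E\<close>])
    then have "ip p (y - p - e) = 0" using assms(2) by (simp add: orth_compl_def)
    then have "(norm (y - e))\<^sup>2 = (norm p)\<^sup>2 + (norm (y - p - e))\<^sup>2"
      using pythagoras[of p "y - p - e"] by simp
    then have "(norm p)\<^sup>2 \<le> (norm (y - e))\<^sup>2" by simp
    then show "norm p \<le> r"
      unfolding \<open>r = norm (y - e)\<close> by (rule power2_le_imp_le) simp
  qed
  then show ?thesis
    using quotient_norm_coset[OF normed_space_over_axioms assms(1)] by simp
qed

end

section \<open>Operator parts of a linear relation\<close>

lemma (in normed_space_over) linear_relation_multivalued_part: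
  assumes X: "normed_space_over scaleX" and T: "T \<in> linear_relations scaleX scale"
  shows "subspace (T `` {0})"
    and "(x, y) \<in> T \<Longrightarrow> (x, y') \<in> T \<Longrightarrow> y - y' \<in> T `` {0}"
    and "(x, y) \<in> T \<Longrightarrow> z \<in> T `` {0} \<Longrightarrow> (x, y - z) \<in> T"
proof -
  interpret X: normed_space_over scaleX by fact
  have zero: "(0, 0) \<in> T"
    and add: "\<And>x y x' y'. (x, y) \<in> T \<Longrightarrow> (x', y') \<in> T \<Longrightarrow> (x + x', y + y') \<in> T"
    and sc: "\<And>c x y. (x, y) \<in> T \<Longrightarrow> (scaleX c x, scale c y) \<in> T"
    using T unfolding linear_relations_iff[OF X.vector_space_axioms vector_space_axioms] by blast+
  show sub: "subspace (T `` {0})"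
    by (rule subspaceI) (use zero add[of 0 _ 0] sc[of 0] in auto)
  have neg: "(- x, - y) \<in> T" if "(x, y) \<in> T" for x y
    using sc[OF that, of "- 1"] by simp
  show "y - y' \<in> T `` {0}" if "(x, y) \<in> T" "(x, y') \<in> T"
    using add[OF that(1) neg[OF that(2)]] by simp
  show "(x, y - z) \<in> T" if "(x, y) \<in> T" "z \<in> T `` {0}"
    using add[OF that(1), of "- 0" "- z"] neg[of 0 z] that(2) by simp
qed

lemma Domain_hat_part: "Domain (hat_part ip T) = Domain T"
  by (auto simp: hat_part_def graph_of_def)

lemma (in normed_space_over) lr_norm_at_eq_quotient_norm:
  assumes X: "normed_space_over scaleX" and T: "T \<in> linear_relations scaleX scale"
    and xy: "(x, y) \<in> T"
  shows "lr_norm_at T x = quotient_norm (y +o closure (T `` {0}))"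
proof -
  note M = linear_relation_multivalued_part[OF X T]
  define E where "E = closure (T `` {0})"
  have E: "subspace E" unfolding E_def by (rule subspace_closure[OF M(1)])
  have coset_le: "u +o E \<subseteq> v +o E" if "(x, u) \<in> T" "(x, v) \<in> T" for u v
  proof
    fix w assume "w \<in> u +o E"
    then obtain e where e: "e \<in> E" "w = u + e" by (auto simp: elt_set_plus_def)
    have "u - v \<in> E"
      using M(2)[OF that] closure_subset unfolding E_def by blast
    then have "(u - v) + e \<in> E" using e(1) by (rule subspace_add[OF E])
    moreover have "w = v + ((u - v) + e)" by (simp add: e(2))
    ultimately show "w \<in> v +o E" unfolding elt_set_plus_def by blast
  qed
  have coset_eq: "y' +o E = y +o E" if "(x, y') \<in> T" for y'
    using coset_le[OF that xy] coset_le[OF xy that] by blast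
  have "(x, C) \<in> tilde_part T \<longleftrightarrow> (\<exists>y'. (x, y') \<in> T \<and> C = y' +o E)" for C
    by (auto simp: tilde_part_def graph_of_def quotient_map_def E_def)
  then have "(x, C) \<in> tilde_part T \<longleftrightarrow> C = y +o E" for C
    using xy coset_eq by metis
  then show ?thesis
    by (simp add: lr_norm_at_def rel_value_def E_def)
qed

text \<open>
  Elements of \<open>T(x)\<close> are congruent modulo \<open>E\<close> and therefore have the same projection onto \<open>E\<^sup>\<bottom>\<close>. Hence
  \<open>hat_part ip T\<close> is single-valued, and its norm at \<open>x\<close> is the ordinary norm of that projection.
\<close>

lemma (in hilbert_space_over) lr_norm_at_hat_part:
  assumes X: "normed_space_over scaleX" and T: "T \<in> linear_relations scaleX scale"
    and x: "x \<in> Domain T"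
  shows "lr_norm_at (hat_part ip T) x = lr_norm_at T x"
proof -
  define E where "E = closure (T `` {0})"
  define P where "P = orth_proj ip (orth_compl ip E)"
  note M = linear_relation_multivalued_part[OF X T]
  have E: "subspace E" "closed E" unfolding E_def by (simp_all add: subspace_closure[OF M(1)])
  have hat: "hat_part ip T = {(x, P y) |x y. (x, y) \<in> T}"
    by (auto simp: hat_part_def graph_of_def P_def E_def)
  have P: "P y \<in> orth_compl ip E \<and> y - P y \<in> E" for y
    using perpendicular_exists[OF E] orth_proj_eqI unfolding P_def by metis
  have P_cong: "P y = P y'" if "(x, y) \<in> T" "(x, y') \<in> T" for x y y'
  proof -
    have "y - y' \<in> E" using M(2)[OF that] closure_subset unfolding E_def by blast
    then have "y - P y' \<in> E" using P[of y'] subspace_add[OF E(1), of "y - y'" "y' - P y'"] by simp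
    then show ?thesis using orth_proj_eqI P unfolding P_def by blast
  qed
  have sv: "single_valued (hat_part ip T)"
    unfolding hat single_valued_def using P_cong by blast
  have "(0, 0) \<in> T" using subspace_0[OF M(1)] by simp
  moreover have "P 0 = 0" unfolding P_def
    by (rule orth_proj_eqI) (simp_all add: orth_compl_def ip_zero_left subspace_0[OF E(1)])
  ultimately have 0: "(0, 0) \<in> hat_part ip T" unfolding hat by force
  obtain y where y: "(x, y) \<in> T" using x by blast
  have "lr_norm_at (hat_part ip T) x = norm (P y)"
    by (rule lr_norm_at_single_valued[OF sv 0]) (use y hat in blast)
  also have "\<dots> = quotient_norm (y +o E)"
    using quotient_norm_eq_norm_perpendicular[OF E(1)] P by metis
  also have "\<dots> = lr_norm_at T x"
    using lr_norm_at_eq_quotient_norm[OF X T y] by (simp add: E_def)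
  finally show ?thesis .
qed

lemma (in hilbert_space_over) lr_norm_hat_part:
  assumes "normed_space_over scaleX" "T \<in> linear_relations scaleX scale"
  shows "lr_norm (hat_part ip T) = lr_norm T"
  unfolding lr_norm_def Domain_hat_part
  by (intro SUP_cong refl) (simp add: lr_norm_at_hat_part[OF assms])

text \<open>
  Both sets consist of the pairs \<open>(x, p) \<in> T\<close> with \<open>p\<close> orthogonal to \<open>T(0)\<close>. For \<open>s_part ip T\<close> this is the
  definition; a value \<open>p\<close> of \<open>hat_part ip T\<close> differs from some \<open>y \<in> T(x)\<close> by an element of the closure of
  \<open>T(0)\<close>, and closedness of \<open>T\<close> puts that element in \<open>T(0)\<close> itself.
\<close>

lemma (in hilbert_space_over) s_part_eq_hat_part:
  assumes T: "T \<in> linear_relations scale scale" and "closed T"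
  shows "s_part ip T = hat_part ip T"
proof -
  define E where "E = T `` {0}"
  note M = linear_relation_multivalued_part[OF normed_space_over_axioms T, folded E_def]
  \<comment> \<open>\<open>T(0)\<close> is the preimage of \<open>T\<close> under the continuous map \<open>y \<mapsto> (0, y)\<close>.\<close>
  have "closed ((\<lambda>y. (0, y)) -` T)"
    by (intro closed_vimage \<open>closed T\<close> continuous_intros)
  then have E: "closed E" by (simp add: E_def vimage_def Image_singleton)
  have s: "(x, y) \<in> s_part ip T \<longleftrightarrow> (x, y) \<in> T \<and> y \<in> orth_compl ip E" for x y
    by (auto simp: s_part_def orth_compl_def infinity_part_def prod_ip_def E_def ip_zero_right)
  have hat: "(x, p) \<in> hat_part ip T \<longleftrightarrow>
      (\<exists>y. (x, y) \<in> T \<and> p = orth_proj ip (orth_compl ip E) y)" for x p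
    by (auto simp: hat_part_def graph_of_def E_def[symmetric] closure_closed[OF E])
  show ?thesis
  proof (intro set_eqI iffI; clarify)
    fix x y assume "(x, y) \<in> s_part ip T"
    then show "(x, y) \<in> hat_part ip T"
      unfolding s hat using orth_proj_eqI[of y E y] subspace_0[OF M(1)] by auto
  next
    fix x p assume "(x, p) \<in> hat_part ip T"
    then obtain y where y: "(x, y) \<in> T" "p = orth_proj ip (orth_compl ip E) y"
      unfolding hat by blast
    have p: "p \<in> orth_compl ip E" "y - p \<in> E"
      using perpendicular_exists[OF M(1) E, of y] orth_proj_eqI y(2) by metis+
    then show "(x, p) \<in> s_part ip T"
      unfolding s using M(3)[OF y(1) p(2)] by simp
  qed
qed

theorem theorem2p4:
  fixes scaleX :: "'k::real_or_complex \<Rightarrow> 'a::real_normed_vector \<Rightarrow> 'a"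
    and scaleY :: "'k \<Rightarrow> 'b::banach \<Rightarrow> 'b"
    and ip :: "'b \<Rightarrow> 'b \<Rightarrow> 'k"
  assumes "normed_space_over scaleX"
    and "hilbert_space_over scaleY ip"
  shows "(\<forall>T \<in> linear_relations scaleX scaleY.
      (\<forall>x \<in> Domain T. lr_norm_at (hat_part ip T) x = lr_norm_at T x) \<and>
      lr_norm (hat_part ip T) = lr_norm T \<and>
      (lr_bounded T \<longleftrightarrow> lr_bounded (hat_part ip T))) \<and>
    (\<forall>T \<in> linear_relations scaleY scaleY. closed T \<longrightarrow>
      (\<forall>x \<in> Domain T.
        lr_norm_at (s_part ip T) x = lr_norm_at (hat_part ip T) x \<and>
        lr_norm_at (hat_part ip T) x = lr_norm_at T x) \<and>
      lr_norm (s_part ip T) = lr_norm (hat_part ip T) \<and>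
      lr_norm (hat_part ip T) = lr_norm T \<and>
      (lr_bounded T \<longleftrightarrow> lr_bounded (hat_part ip T)) \<and>
      (lr_bounded (hat_part ip T) \<longleftrightarrow> lr_bounded (s_part ip T)))"
proof -
  interpret Y: hilbert_space_over scaleY ip by fact
  note hat = Y.lr_norm_at_hat_part Y.lr_norm_hat_part
  show ?thesis
    using hat[OF assms(1)] hat[OF Y.normed_space_over_axioms] Y.s_part_eq_hat_part
    by (simp add: lr_bounded_def)
qed

end
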